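(* If $(\{A_n\}_{n},\{\Psi_n\}_{n})$ and $(\{B_n\}_{n},\{\Phi_n\}_{n})$ are orthogonal operator-valued p-ASFs in $\mathcal{B}(\mathcal{X},\mathcal{Y})$, then $(\{A_n\oplus B_n\}_{n},\{\Psi_n\oplus\Phi_n\}_{n})$ is an operator-valued p-ASF in $\mathcal{B}(\mathcal{X}\oplus\mathcal{X},\mathcal{Y})$, where $(A_n\oplus B_n)(x\oplus x_1)=A_nx+B_nx_1$ for $x,x_1\in\mathcal{X}$ and $(\Psi_n\oplus\Phi_n)y=\Psi_ny\oplus\Phi_ny$ for $y\in\mathcal{Y}$. Further, if both $(\{A_n\}_{n},\{\Psi_n\}_{n})$ and $(\{B_n\}_{n},\{\Phi_n\}_{n})$ are Parseval, then $(\{A_n\oplus B_n\}_{n},\{\Psi_n\oplus\Phi_n\}_{n})$ is Parseval.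
   Context: Banach spaces are over $\mathbb{K}=\mathbb{R}$ or $\mathbb{C}$; $\mathcal{X},\mathcal{Y}$ are Banach spaces, $p\in[1,\infty)$, $\mathcal{B}(\mathcal{X},\mathcal{Y})$ is the space of bounded linear operators. $\ell^p(\mathbb{N})\otimes\mathcal{Y}$ is the completion of the algebraic tensor product in a fixed cross norm ($\|a\otimes y\|=\|a\|\|y\|$) for which, for all $T\in\mathcal{B}(\ell^p(\mathbb{N}))$ and $R\in\mathcal{B}(\mathcal{Y})$, $T\otimes R$ extends to a bounded operator with $\|T\otimes R\|\le\|T\|\|R\|$. With $\{e_n\}_n$ the standard Schauder basis of $\ell^p(\mathbb{N})$, $L_n:\mathcal{Y}\to\ell^p(\mathbb{N})\otimes\mathcal{Y}$ is $L_ny=e_n\otimes y$, and $\Gamma_n:\ell^p(\mathbb{N})\otimes\mathcal{Y}\to\mathcal{Y}$ is the bounded linear operator with $\Gamma_n(\{a_m\}_m\otimes y)=a_ny$. Thus $\Gamma_nL_n=I_{\mathcal{Y}}$, $\Gamma_nL_m=0$ for $n\ne m$, and $\sum_{n=1}^\infty L_n\Gamma_nz=z$ for all $z$. For collections $\{A_n\}_{n}$ in $\mathcal{B}(\mathcal{X},\mathcal{Y})$ and $\{\Psi_n\}_{n}$ in $\mathcal{B}(\mathcal{Y},\mathcal{X})$, the pair is an operator-valued p-approximate Schauder frame (operator-valued p-ASF) in $\mathcal{B}(\mathcal{X},\mathcal{Y})$ if: (i) the frame operator $S_{A,\Psi}x=\sum_{n=1}^\infty\Psi_nA_nx$ is a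 well-defined bounded linear invertible operator on $\mathcal{X}$; (ii) the analysis operator $\theta_A:\mathcal{X}\to\ell^p(\mathbb{N})\otimes\mathcal{Y}$, $\theta_Ax=\sum_{n=1}^\infty L_nA_nx$, is a well-defined bounded linear operator; (iii) the synthesis operator $\theta_\Psi:\ell^p(\mathbb{N})\otimes\mathcal{Y}\to\mathcal{X}$, $\theta_\Psi z=\sum_{n=1}^\infty\Psi_n\Gamma_nz$, is a well-defined bounded linear operator. It is Parseval if $S_{A,\Psi}=I_{\mathcal{X}}$. The same definition applies with $\mathcal{X}$ replaced by the Banach space direct sum $\mathcal{X}\oplus\mathcal{X}$ (with any of the usual equivalent norms). Two operator-valued p-ASFs $(\{A_n\}_{n},\{\Psi_n\}_{n})$ and $(\{B_n\}_{n},\{\Phi_n\}_{n})$ are orthogonal if $\theta_\Psi\theta_B=\theta_\Phi\theta_A=0$. *)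

theory Defs
  imports "HOL-Analysis.Analysis"
begin

(* Banach spaces over K = R or K = C.  The scalar field is a type 'k of class real_normed_field:
   by Mazur's theorem such a field is isometrically isomorphic to real or complex.
   Addition, norm and completeness come from the class banach, whose real scalar
   multiplication has to be the restriction of the K-scalar multiplication. *)

locale banach_over = vector_space scale
  for scale :: "'k::real_normed_field \<Rightarrow> 'x::banach \<Rightarrow> 'x" +
  assumes norm_scale: "norm (scale c x) = norm c * norm x"
    and scale_of_real: "scale (of_real r) x = r *\<^sub>R x"

definition bounded_op ::
  "('k::real_normed_field \<Rightarrow> 'x::banach \<Rightarrow> 'x) \<Rightarrow> ('k \<Rightarrow> 'y::banach \<Rightarrow> 'y) \<Rightarrow> ('x \<Rightarrow> 'y) \<Rightarrow> bool" where
  "bounded_op s1 s2 f \<longleftrightarrow> Vector_Spaces.linear s1 s2 f \<and> bounded_linear f"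

definition invertible_op :: "('k::real_normed_field \<Rightarrow> 'x::banach \<Rightarrow> 'x) \<Rightarrow> ('x \<Rightarrow> 'x) \<Rightarrow> bool" where
  "invertible_op s f \<longleftrightarrow>
     bounded_op s s f \<and> (\<exists>g. bounded_op s s g \<and> g \<circ> f = id \<and> f \<circ> g = id)"


(* Sequences are indexed from 0. *)

definition lp :: "real \<Rightarrow> (nat \<Rightarrow> 'k::real_normed_field) set" where
  "lp p = {a. summable (\<lambda>n. norm (a n) powr p)}"

definition lp_norm :: "real \<Rightarrow> (nat \<Rightarrow> 'k::real_normed_field) \<Rightarrow> real" where
  "lp_norm p a = (\<Sum>n. norm (a n) powr p) powr (1 / p)"

definition unit_seq :: "nat \<Rightarrow> nat \<Rightarrow> 'k::real_normed_field" where
  "unit_seq n = (\<lambda>m. if m = n then 1 else 0)"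

(* Bounded linear operators on lp; only the values on lp p matter. *)
definition lp_op :: "real \<Rightarrow> ((nat \<Rightarrow> 'k::real_normed_field) \<Rightarrow> (nat \<Rightarrow> 'k)) \<Rightarrow> bool" where
  "lp_op p T \<longleftrightarrow>
     (\<forall>a\<in>lp p. T a \<in> lp p) \<and>
     (\<forall>a\<in>lp p. \<forall>b\<in>lp p. T (\<lambda>n. a n + b n) = (\<lambda>n. T a n + T b n)) \<and>
     (\<forall>c. \<forall>a\<in>lp p. T (\<lambda>n. c * a n) = (\<lambda>n. c * T a n)) \<and>
     (\<exists>C. \<forall>a\<in>lp p. lp_norm p (T a) \<le> C * lp_norm p a)"

(* Operator norm, written as in the library's onorm (0 / 0 = 0). *)
definition lp_onorm :: "real \<Rightarrow> ((nat \<Rightarrow> 'k::real_normed_field) \<Rightarrow> (nat \<Rightarrow> 'k)) \<Rightarrow> real" where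
  "lp_onorm p T = (SUP a\<in>lp p. lp_norm p (T a) / lp_norm p a)"


(* The algebraic tensor product of lp and Y, realised in the usual way (e.g. Ryan,
   Introduction to Tensor Products of Banach Spaces) as a space of functionals on the
   bilinear forms on lp x Y: the elementary tensor of a and y is evaluation at (a, y),
   and the tensor product consists of the finite sums of elementary tensors.  Arguments that
   are not bilinear forms are sent to 0. *)

definition bilinear_form ::
  "real \<Rightarrow> ('k::real_normed_field \<Rightarrow> 'y::banach \<Rightarrow> 'y) \<Rightarrow> ((nat \<Rightarrow> 'k) \<Rightarrow> 'y \<Rightarrow> 'k) \<Rightarrow> bool" where
  "bilinear_form p sY \<beta> \<longleftrightarrow>
     (\<forall>a\<in>lp p. Vector_Spaces.linear sY (*) (\<beta> a)) \<and>
     (\<forall>a\<in>lp p. \<forall>b\<in>lp p. \<forall>y. \<beta> (\<lambda>n. a n + b n) y = \<beta> a y + \<beta> b y) \<and>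
     (\<forall>c. \<forall>a\<in>lp p. \<forall>y. \<beta> (\<lambda>n. c * a n) y = c * \<beta> a y)"

type_synonym ('k, 'y) tensor = "((nat \<Rightarrow> 'k) \<Rightarrow> 'y \<Rightarrow> 'k) \<Rightarrow> 'k"

definition elem_tensor ::
  "real \<Rightarrow> ('k::real_normed_field \<Rightarrow> 'y::banach \<Rightarrow> 'y) \<Rightarrow> (nat \<Rightarrow> 'k) \<Rightarrow> 'y \<Rightarrow> ('k, 'y) tensor" where
  "elem_tensor p sY a y = (\<lambda>\<beta>. if bilinear_form p sY \<beta> then \<beta> a y else 0)"

definition alg_tensor ::
  "real \<Rightarrow> ('k::real_normed_field \<Rightarrow> 'y::banach \<Rightarrow> 'y) \<Rightarrow> ('k, 'y) tensor set" where
  "alg_tensor p sY =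
     {u. \<exists>(m::nat) a y. (\<forall>i<m. a i \<in> lp p) \<and> u = (\<lambda>\<beta>. \<Sum>i<m. elem_tensor p sY (a i) (y i) \<beta>)}"

(* N is a cross norm on the algebraic tensor product, and the Banach space 'z together with
   the isometric linear map J with dense range is the completion in that norm, such that
   every T (x) R extends to the completion with norm at most |T| |R|. *)

locale lp_tensor_completion =
  Y: banach_over sY + Z: banach_over sZ
  for p :: real
    and sY :: "'k::real_normed_field \<Rightarrow> 'y::banach \<Rightarrow> 'y"
    and sZ :: "'k \<Rightarrow> 'z::banach \<Rightarrow> 'z"
    and N :: "('k, 'y) tensor \<Rightarrow> real"
    and J :: "('k, 'y) tensor \<Rightarrow> 'z" +
  assumes p_ge_1: "1 \<le> p"
    and N_triangle: "u \<in> alg_tensor p sY \<Longrightarrow> v \<in> alg_tensor p sY \<Longrightarrow> N (\<lambda>\<beta>. u \<beta> + v \<beta>) \<le> N u + N v"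
    and N_scale: "u \<in> alg_tensor p sY \<Longrightarrow> N (\<lambda>\<beta>. c * u \<beta>) = norm c * N u"
    and N_eq_0: "u \<in> alg_tensor p sY \<Longrightarrow> N u = 0 \<Longrightarrow> u = (\<lambda>\<beta>. 0)"
    and N_cross: "a \<in> lp p \<Longrightarrow> N (elem_tensor p sY a y) = lp_norm p a * norm y"
    and J_add: "u \<in> alg_tensor p sY \<Longrightarrow> v \<in> alg_tensor p sY \<Longrightarrow> J (\<lambda>\<beta>. u \<beta> + v \<beta>) = J u + J v"
    and J_scale: "u \<in> alg_tensor p sY \<Longrightarrow> J (\<lambda>\<beta>. c * u \<beta>) = sZ c (J u)"
    and J_isometric: "u \<in> alg_tensor p sY \<Longrightarrow> norm (J u) = N u"
    and J_dense: "closure (J ` alg_tensor p sY) = UNIV"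
    and tensor_op: "lp_op p T \<Longrightarrow> bounded_op sY sY R \<Longrightarrow>
      \<exists>W. bounded_op sZ sZ W \<and>
          (\<forall>a\<in>lp p. \<forall>y. W (J (elem_tensor p sY a y)) = J (elem_tensor p sY (T a) (R y))) \<and>
          onorm W \<le> lp_onorm p T * onorm R"

definition L ::
  "real \<Rightarrow> ('k::real_normed_field \<Rightarrow> 'y::banach \<Rightarrow> 'y) \<Rightarrow> (('k, 'y) tensor \<Rightarrow> 'z::banach) \<Rightarrow> nat \<Rightarrow> 'y \<Rightarrow> 'z" where
  "L p sY J n y = J (elem_tensor p sY (unit_seq n) y)"

(* In an lp_tensor_completion there is exactly one such operator: it is unique by density,
   and it exists because the extension of E_n (x) I, where E_n projects onto the n-th
   coordinate, takes its values in the range of the isometry L n. *)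
definition \<Gamma> ::
  "real \<Rightarrow> ('k::real_normed_field \<Rightarrow> 'y::banach \<Rightarrow> 'y) \<Rightarrow> ('k \<Rightarrow> 'z::banach \<Rightarrow> 'z) \<Rightarrow>
   (('k, 'y) tensor \<Rightarrow> 'z) \<Rightarrow> nat \<Rightarrow> 'z \<Rightarrow> 'y" where
  "\<Gamma> p sY sZ J n =
     (THE G. bounded_op sZ sY G \<and> (\<forall>a\<in>lp p. \<forall>y. G (J (elem_tensor p sY a y)) = sY (a n) y))"


definition frame_op :: "(nat \<Rightarrow> 'x \<Rightarrow> 'y) \<Rightarrow> (nat \<Rightarrow> 'y \<Rightarrow> 'x::banach) \<Rightarrow> 'x \<Rightarrow> 'x" where
  "frame_op A \<Psi> x = (\<Sum>n. \<Psi> n (A n x))"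

definition analysis_op ::
  "real \<Rightarrow> ('k::real_normed_field \<Rightarrow> 'y::banach \<Rightarrow> 'y) \<Rightarrow> (('k, 'y) tensor \<Rightarrow> 'z::banach) \<Rightarrow>
   (nat \<Rightarrow> 'x \<Rightarrow> 'y) \<Rightarrow> 'x \<Rightarrow> 'z" where
  "analysis_op p sY J A x = (\<Sum>n. L p sY J n (A n x))"

definition synthesis_op ::
  "real \<Rightarrow> ('k::real_normed_field \<Rightarrow> 'y::banach \<Rightarrow> 'y) \<Rightarrow> ('k \<Rightarrow> 'z::banach \<Rightarrow> 'z) \<Rightarrow>
   (('k, 'y) tensor \<Rightarrow> 'z) \<Rightarrow> (nat \<Rightarrow> 'y \<Rightarrow> 'x::banach) \<Rightarrow> 'z \<Rightarrow> 'x" where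
  "synthesis_op p sY sZ J \<Psi> z = (\<Sum>n. \<Psi> n (\<Gamma> p sY sZ J n z))"

definition ov_pASF ::
  "real \<Rightarrow> ('k::real_normed_field \<Rightarrow> 'x::banach \<Rightarrow> 'x) \<Rightarrow> ('k \<Rightarrow> 'y::banach \<Rightarrow> 'y) \<Rightarrow>
   ('k \<Rightarrow> 'z::banach \<Rightarrow> 'z) \<Rightarrow> (('k, 'y) tensor \<Rightarrow> 'z) \<Rightarrow>
   (nat \<Rightarrow> 'x \<Rightarrow> 'y) \<Rightarrow> (nat \<Rightarrow> 'y \<Rightarrow> 'x) \<Rightarrow> bool" where
  "ov_pASF p sX sY sZ J A \<Psi> \<longleftrightarrow>
     (\<forall>n. bounded_op sX sY (A n)) \<and> (\<forall>n. bounded_op sY sX (\<Psi> n)) \<and>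
     (\<forall>x. summable (\<lambda>n. \<Psi> n (A n x))) \<and> invertible_op sX (frame_op A \<Psi>) \<and>
     (\<forall>x. summable (\<lambda>n. L p sY J n (A n x))) \<and> bounded_op sX sZ (analysis_op p sY J A) \<and>
     (\<forall>z. summable (\<lambda>n. \<Psi> n (\<Gamma> p sY sZ J n z))) \<and> bounded_op sZ sX (synthesis_op p sY sZ J \<Psi>)"

definition parseval_ov_pASF ::
  "real \<Rightarrow> ('k::real_normed_field \<Rightarrow> 'x::banach \<Rightarrow> 'x) \<Rightarrow> ('k \<Rightarrow> 'y::banach \<Rightarrow> 'y) \<Rightarrow>
   ('k \<Rightarrow> 'z::banach \<Rightarrow> 'z) \<Rightarrow> (('k, 'y) tensor \<Rightarrow> 'z) \<Rightarrow>
   (nat \<Rightarrow> 'x \<Rightarrow> 'y) \<Rightarrow> (nat \<Rightarrow> 'y \<Rightarrow> 'x) \<Rightarrow> bool" where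
  "parseval_ov_pASF p sX sY sZ J A \<Psi> \<longleftrightarrow> ov_pASF p sX sY sZ J A \<Psi> \<and> frame_op A \<Psi> = id"

definition orthogonal_ov_pASF ::
  "real \<Rightarrow> ('k::real_normed_field \<Rightarrow> 'x::banach \<Rightarrow> 'x) \<Rightarrow> ('k \<Rightarrow> 'y::banach \<Rightarrow> 'y) \<Rightarrow>
   ('k \<Rightarrow> 'z::banach \<Rightarrow> 'z) \<Rightarrow> (('k, 'y) tensor \<Rightarrow> 'z) \<Rightarrow>
   (nat \<Rightarrow> 'x \<Rightarrow> 'y) \<Rightarrow> (nat \<Rightarrow> 'y \<Rightarrow> 'x) \<Rightarrow>
   (nat \<Rightarrow> 'x \<Rightarrow> 'y) \<Rightarrow> (nat \<Rightarrow> 'y \<Rightarrow> 'x) \<Rightarrow> bool" where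
  "orthogonal_ov_pASF p sX sY sZ J A \<Psi> B \<Phi> \<longleftrightarrow>
     ov_pASF p sX sY sZ J A \<Psi> \<and> ov_pASF p sX sY sZ J B \<Phi> \<and>
     synthesis_op p sY sZ J \<Psi> \<circ> analysis_op p sY J B = (\<lambda>x. 0) \<and>
     synthesis_op p sY sZ J \<Phi> \<circ> analysis_op p sY J A = (\<lambda>x. 0)"

(* The direct sum of X with itself is the type 'x * 'x with the library's norm
   sqrt (|x|^2 + |x1|^2) and the scalar multiplication module_prod.scale sX sX. *)

definition sum_analysis :: "(nat \<Rightarrow> 'x \<Rightarrow> 'y::banach) \<Rightarrow> (nat \<Rightarrow> 'x \<Rightarrow> 'y) \<Rightarrow> nat \<Rightarrow> 'x \<times> 'x \<Rightarrow> 'y" where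
  "sum_analysis A B n = (\<lambda>(x, x1). A n x + B n x1)"

definition sum_synthesis :: "(nat \<Rightarrow> 'y \<Rightarrow> 'x) \<Rightarrow> (nat \<Rightarrow> 'y \<Rightarrow> 'x) \<Rightarrow> nat \<Rightarrow> 'y \<Rightarrow> 'x \<times> 'x" where
  "sum_synthesis \<Psi> \<Phi> n = (\<lambda>y. (\<Psi> n y, \<Phi> n y))"

end

theory Submission
  imports Defs
begin

text \<open>
  Write \<open>\<theta>\<^sub>C\<close> for analysis, \<open>\<theta>\<^sub>\<Psi>\<close> for synthesis and \<open>S\<^sub>\<Psi>\<^sub>C\<close> for the operator
  \<open>x \<mapsto> \<Sum>n. \<Psi> n (C n x)\<close>.  The point is the factorisation \<open>S\<^sub>\<Psi>\<^sub>C = \<theta>\<^sub>\<Psi> \<circ> \<theta>\<^sub>C\<close>, valid for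
  \<open>C\<close> and \<open>\<Psi>\<close> from different frames, because it rests only on the convergence of the analysis
  series of \<open>C\<close> and of the synthesis series of \<open>\<Psi>\<close>.  The frame
  operator of the direct sum, written as a \<open>2 \<times> 2\<close> matrix on the two copies of the space, has the
  entries \<open>S\<^sub>\<Psi>\<^sub>A\<close>, \<open>S\<^sub>\<Psi>\<^sub>B\<close>, \<open>S\<^sub>\<Phi>\<^sub>A\<close>, \<open>S\<^sub>\<Phi>\<^sub>B\<close>.  By the factorisation, orthogonality says exactly that
  the off-diagonal entries vanish, so the frame operator is the diagonal matrix of
  the two given frame operators: invertible because both are, and the identity if both are.
  The analysis operator of the direct sum is the row \<open>(\<theta>\<^sub>A, \<theta>\<^sub>B)\<close> and its synthesis operator the
  column with entries \<open>\<theta>\<^sub>\<Psi>\<close> and \<open>\<theta>\<^sub>\<Phi>\<close>; both are bounded.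

  The factorisation (\<open>sums_synthesis_analysis\<close>) is read off term by term from
  \<open>\<Gamma> n (L m y) = (if m = n then y else 0)\<close> and the continuity of \<open>\<Gamma> n\<close>.  As \<open>\<Gamma> n\<close> is given by a
  definite description, these two properties depend on its existence and
  uniqueness.  Uniqueness holds because elementary tensors span a dense subspace.  For existence
  (\<open>coordinate_operator_exists\<close>), the tensor product of the \<open>n\<close>-th coordinate projection with the
  identity extends to the completion and maps it into the range of the isometry \<open>L n\<close>;
  composing with the inverse of \<open>L n\<close> yields \<open>\<Gamma> n\<close>.
\<close>

section \<open>Bounded operators and direct sums\<close>

text \<open>Additivity is part of \<^const>\<open>bounded_linear\<close>, so the only extra demand on a bounded
  operator is homogeneity over the scalar field.\<close>

lemma bounded_op_iff:
  assumes "vector_space s1" and "vector_space s2"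
  shows "bounded_op s1 s2 f \<longleftrightarrow> bounded_linear f \<and> (\<forall>c x. f (s1 c x) = s2 c (f x))"
  using assms
  by (auto simp: bounded_op_def Vector_Spaces.linear_iff linear_add dest: bounded_linear.linear)

lemma bounded_op_bounded_linear: "bounded_op s1 s2 f \<Longrightarrow> bounded_linear f"
  by (simp add: bounded_op_def)

lemma bounded_op_scale: "bounded_op s1 s2 f \<Longrightarrow> f (s1 c x) = s2 c (f x)"
  by (simp add: bounded_op_def Vector_Spaces.linear_iff)

lemma (in banach_over) vector_space_direct_sum:
  "vector_space (module_prod.scale scale scale)"
proof -
  interpret prod: vector_space_prod scale scale ..
  show ?thesis by (rule prod.p.vector_space_axioms)
qed

lemma (in banach_over) direct_sum_scale:
  "module_prod.scale scale scale c x = (scale c (fst x), scale c (snd x))"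
proof -
  interpret prod: vector_space_prod scale scale ..
  show ?thesis by (simp add: prod.scale_def)
qed

lemma (in banach_over) bounded_op_add_components:
  assumes "vector_space s" and "bounded_op scale s f" and "bounded_op scale s g"
  shows "bounded_op (module_prod.scale scale scale) s (\<lambda>x. f (fst x) + g (snd x))"
  using assms
  by (auto simp: bounded_op_iff vector_space_axioms vector_space_direct_sum direct_sum_scale
      vector_space.vector_space_assms(1)
      intro!: bounded_linear_add bounded_linear_compose[OF _ bounded_linear_fst]
      bounded_linear_compose[OF _ bounded_linear_snd])

lemma (in banach_over) bounded_op_Pair:
  assumes "vector_space s" and "bounded_op s scale f" and "bounded_op s scale g"
  shows "bounded_op s (module_prod.scale scale scale) (\<lambda>y. (f y, g y))"
  using assms
  by (simp add: bounded_op_iff vector_space_axioms vector_space_direct_sum direct_sum_scale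
      bounded_linear_Pair)

lemma (in banach_over) bounded_op_map_prod:
  assumes "bounded_op scale scale f" and "bounded_op scale scale g"
  shows "bounded_op (module_prod.scale scale scale) (module_prod.scale scale scale) (map_prod f g)"
proof -
  have "bounded_linear (\<lambda>x. (f (fst x), g (snd x)))"
    by (intro bounded_linear_Pair bounded_linear_compose[OF _ bounded_linear_fst]
        bounded_linear_compose[OF _ bounded_linear_snd] assms[THEN bounded_op_bounded_linear])
  then show ?thesis
    by (simp add: bounded_op_iff vector_space_direct_sum direct_sum_scale map_prod_def
        case_prod_unfold assms[THEN bounded_op_scale])
qed

lemma (in banach_over) invertible_op_map_prod:
  assumes "invertible_op scale f" and "invertible_op scale g"
  shows "invertible_op (module_prod.scale scale scale) (map_prod f g)"
proof -
  obtain f' g' where "bounded_op scale scale f'" "f' \<circ> f = id" "f \<circ> f' = id"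
    and "bounded_op scale scale g'" "g' \<circ> g = id" "g \<circ> g' = id"
    using assms unfolding invertible_op_def by blast
  with assms show ?thesis
    unfolding invertible_op_def
    by (intro conjI exI[of _ "map_prod f' g'"] bounded_op_map_prod)
      (simp_all add: map_prod.comp map_prod.id)
qed


section \<open>Coordinates of \<open>p\<close>-summable sequences\<close>

lemma scaled_unit_seq_norm_powr:
  "norm (c * unit_seq n m) powr p = (if m = n then norm c powr p else 0)"
  by (simp add: unit_seq_def)

lemma scaled_unit_seq_in_lp: "(\<lambda>m. c * unit_seq n m) \<in> lp p"
  by (simp add: lp_def scaled_unit_seq_norm_powr)

lemma unit_seq_in_lp: "unit_seq n \<in> lp p"
  using scaled_unit_seq_in_lp[of 1 n p] by simp

lemma lp_norm_scaled_unit_seq: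
  assumes "1 \<le> p"
  shows "lp_norm p (\<lambda>m. c * unit_seq n m) = norm c"
  using assms sums_unique[OF sums_single[of n "\<lambda>_. norm c powr p"]]
  by (simp add: lp_norm_def scaled_unit_seq_norm_powr powr_powr)

lemma norm_coordinate_le_lp_norm:
  assumes "1 \<le> p" and "a \<in> lp p"
  shows "norm (a n) \<le> lp_norm p a"
proof -
  \<comment> \<open>a single term of the defining series is at most the whole series\<close>
  have "norm (a n) powr p \<le> (\<Sum>m. norm (a m) powr p)"
    using sum_le_suminf[of "\<lambda>m. norm (a m) powr p" "{n}"] assms(2) by (simp add: lp_def)
  then have "(norm (a n) powr p) powr (1 / p) \<le> lp_norm p a"
    unfolding lp_norm_def using assms(1) by (intro powr_mono2) auto
  then show ?thesis
    using assms(1) by (simp add: powr_powr)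
qed

text \<open>The projection is contractive since \<open>\<bar>a n\<bar>\<close> is at most the norm of \<open>a\<close>; this
  is what allows the tensor product with it to be extended to the completion.\<close>

lemma lp_op_coordinate_projection:
  assumes "1 \<le> p"
  shows "lp_op p (\<lambda>a m. a n * unit_seq n m)"
  using assms norm_coordinate_le_lp_norm[OF assms]
  by (auto simp: lp_op_def scaled_unit_seq_in_lp lp_norm_scaled_unit_seq algebra_simps
      intro!: exI[of _ 1])


section \<open>The coordinate operators of the completed tensor product\<close>

context lp_tensor_completion
begin

lemma elem_tensor_add: "a \<in> lp p \<Longrightarrow> elem_tensor p sY a (y + y') =
    (\<lambda>\<beta>. elem_tensor p sY a y \<beta> + elem_tensor p sY a y' \<beta>)"
  by (auto simp: elem_tensor_def bilinear_form_def Vector_Spaces.linear_iff fun_eq_iff)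

lemma elem_tensor_scale: "a \<in> lp p \<Longrightarrow> elem_tensor p sY a (sY c y) =
    (\<lambda>\<beta>. c * elem_tensor p sY a y \<beta>)"
  by (auto simp: elem_tensor_def bilinear_form_def Vector_Spaces.linear_iff fun_eq_iff)

lemma elem_tensor_scale_left: "a \<in> lp p \<Longrightarrow> elem_tensor p sY (\<lambda>n. c * a n) y =
    elem_tensor p sY a (sY c y)"
  by (auto simp: elem_tensor_def bilinear_form_def Vector_Spaces.linear_iff fun_eq_iff)

lemma sum_elem_tensor_in_alg_tensor:
  "(\<And>i. i < m \<Longrightarrow> a i \<in> lp p) \<Longrightarrow> (\<lambda>\<beta>. \<Sum>i<(m::nat). elem_tensor p sY (a i) (y i) \<beta>) \<in> alg_tensor p sY"
  unfolding alg_tensor_def by blast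

lemma elem_tensor_in_alg_tensor: "a \<in> lp p \<Longrightarrow> elem_tensor p sY a y \<in> alg_tensor p sY"
  using sum_elem_tensor_in_alg_tensor[of 1 "\<lambda>_. a" "\<lambda>_. y"] by simp

lemma J_sum_elem_tensor:
  "(\<And>i. i < m \<Longrightarrow> a i \<in> lp p) \<Longrightarrow>
    J (\<lambda>\<beta>. \<Sum>i<(m::nat). elem_tensor p sY (a i) (y i) \<beta>) = (\<Sum>i<m. J (elem_tensor p sY (a i) (y i)))"
proof (induction m)
  case 0
  \<comment> \<open>additivity alone leaves the value at the zero tensor open; scaling by \<open>0\<close> settles it\<close>
  then show ?case
    using J_scale[of "\<lambda>\<beta>. 0" 0] sum_elem_tensor_in_alg_tensor[of 0 "\<lambda>_. _" "\<lambda>_. 0"] by simp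
next
  case (Suc m)
  then show ?case
    by (simp add: J_add sum_elem_tensor_in_alg_tensor elem_tensor_in_alg_tensor)
qed

text \<open>Agreement passes from elementary tensors to their finite sums by linearity, and from
  these to the whole space by density and continuity.\<close>

lemma bounded_op_eq_if_eq_on_elem_tensors:
  assumes G: "bounded_op sZ s G" and G': "bounded_op sZ s G'"
    and eq: "\<And>a y. a \<in> lp p \<Longrightarrow> G (J (elem_tensor p sY a y)) = G' (J (elem_tensor p sY a y))"
  shows "G = G'"
proof
  fix z
  interpret D: bounded_linear "\<lambda>z. G z - G' z"
    by (intro bounded_linear_sub G[THEN bounded_op_bounded_linear] G'[THEN bounded_op_bounded_linear])
  have vanish: "G (J u) - G' (J u) = 0" if "u \<in> alg_tensor p sY" for u
    using that by (auto simp: alg_tensor_def J_sum_elem_tensor D.sum eq simp del: right_minus_eq)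
  have "G z - G' z = 0"
  proof (rule continuous_constant_on_closure[where f = "\<lambda>z. G z - G' z"])
    show "continuous_on (closure (J ` alg_tensor p sY)) (\<lambda>z. G z - G' z)"
      by (intro D.continuous_on continuous_on_id)
    show "G w - G' w = 0" if "w \<in> J ` alg_tensor p sY" for w
      using that vanish by blast
    show "z \<in> closure (J ` alg_tensor p sY)"
      by (simp add: J_dense)
  qed
  then show "G z = G' z" by simp
qed

lemma L_scale: "L p sY J n (sY c y) = sZ c (L p sY J n y)"
  by (simp add: L_def elem_tensor_scale J_scale unit_seq_in_lp elem_tensor_in_alg_tensor)

text \<open>The cross norm property with a unit basis vector makes \<open>L n\<close> an isometry.  Hence it is
  injective with closed range, so limits of its values can be pulled back along it.\<close>

lemma norm_L: "norm (L p sY J n y) = norm y"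
  using lp_norm_scaled_unit_seq[of p "1::'k" n]
  by (simp add: L_def J_isometric N_cross p_ge_1 unit_seq_in_lp elem_tensor_in_alg_tensor)

lemma bounded_linear_L: "bounded_linear (L p sY J n)"
proof (rule bounded_linear_intro[where K = 1])
  show "L p sY J n (y + y') = L p sY J n y + L p sY J n y'" for y y'
    by (simp add: L_def elem_tensor_add J_add unit_seq_in_lp elem_tensor_in_alg_tensor)
  show "L p sY J n (r *\<^sub>R y) = r *\<^sub>R L p sY J n y" for r y
    using L_scale[of n "of_real r" y] by (simp add: Y.scale_of_real Z.scale_of_real)
qed (simp add: norm_L)

lemma inj_L: "inj (L p sY J n)"
proof (rule injI)
  fix y y' assume "L p sY J n y = L p sY J n y'"
  then have "norm (y - y') = 0"
    using norm_L[of n "y - y'"] by (simp add: linear_diff[OF bounded_linear.linear[OF bounded_linear_L]])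
  then show "y = y'" by simp
qed

lemma closed_range_L: "closed (range (L p sY J n))"
  by (intro complete_imp_closed complete_isometric_image[of 1] bounded_linear_L)
    (simp_all add: norm_L complete_UNIV)

text \<open>The operator \<open>W\<close> that extends the tensor product of the \<open>n\<close>-th coordinate projection with
  the identity sends \<open>a \<otimes> y\<close> to \<open>e\<^sub>n \<otimes> a\<^sub>n y\<close>, a value of \<open>L n\<close>.  By density and
  closedness of the range, all its values are values of \<open>L n\<close>, and the operator sought is
  \<open>L n\<close> inverted after \<open>W\<close>.\<close>

lemma coordinate_operator_exists:
  "\<exists>G. bounded_op sZ sY G \<and> (\<forall>a\<in>lp p. \<forall>y. G (J (elem_tensor p sY a y)) = sY (a n) y)"
proof -
  let ?L = "L p sY J n"
  interpret L: bounded_linear ?L by (rule bounded_linear_L)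
  have id: "bounded_op sY sY (\<lambda>y. y)"
    by (simp add: bounded_op_iff Y.vector_space_axioms)
  then obtain W where W: "bounded_op sZ sZ W"
    and W_proj: "\<And>a y. a \<in> lp p \<Longrightarrow>
      W (J (elem_tensor p sY a y)) = J (elem_tensor p sY (\<lambda>m. a n * unit_seq n m) y)"
    using tensor_op[OF lp_op_coordinate_projection[OF p_ge_1, of n] id] by blast
  interpret W: bounded_linear W using W by (rule bounded_op_bounded_linear)
  have W_elem: "W (J (elem_tensor p sY a y)) = ?L (sY (a n) y)" if "a \<in> lp p" for a y
    using W_proj[OF that] by (simp add: L_def elem_tensor_scale_left unit_seq_in_lp)
  have W_range: "W z \<in> range ?L" for z
  proof -
    have "W (J u) \<in> range ?L" if "u \<in> alg_tensor p sY" for u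
      using that by (auto simp: alg_tensor_def J_sum_elem_tensor W.sum W_elem L.sum[symmetric])
    then have "W ` J ` alg_tensor p sY \<subseteq> range ?L" by blast
    then have "W ` closure (J ` alg_tensor p sY) \<subseteq> range ?L"
      by (intro image_closure_subset closed_range_L W.continuous_on continuous_on_id)
    then show ?thesis by (auto simp: J_dense)
  qed
  define G where "G z = inv ?L (W z)" for z
  have L_G: "?L (G z) = W z" for z
    using W_range[of z] by (simp add: G_def f_inv_into_f)
  have G_eqI: "G z = y" if "W z = ?L y" for z y
    using that inj_L by (simp add: G_def)
  \<comment> \<open>\<open>L n\<close> is isometric, so \<open>G\<close> inherits the bound of \<open>W\<close>; injectivity gives linearity\<close>
  obtain K where K: "\<And>z. norm (W z) \<le> norm z * K"
    using W.bounded by blast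
  have "bounded_linear G"
  proof (rule bounded_linear_intro)
    show "norm (G z) \<le> norm z * K" for z
      using K[of z] by (metis L_G norm_L)
  qed (auto intro!: G_eqI simp: W.add W.scaleR L.add L.scaleR L_G)
  moreover have "G (sZ c z) = sY c (G z)" for c z
    by (rule G_eqI) (simp add: L_scale L_G bounded_op_scale[OF W])
  ultimately have "bounded_op sZ sY G"
    by (simp add: bounded_op_iff Y.vector_space_axioms Z.vector_space_axioms)
  moreover have "G (J (elem_tensor p sY a y)) = sY (a n) y" if "a \<in> lp p" for a y
    using that by (intro G_eqI W_elem)
  ultimately show ?thesis by blast
qed

text \<open>The definite description defining \<open>\<Gamma> n\<close> denotes: existence and uniqueness both hold.\<close>

lemma \<Gamma>_coordinate_operator: "bounded_op sZ sY (\<Gamma> p sY sZ J n) \<and>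
    (\<forall>a\<in>lp p. \<forall>y. \<Gamma> p sY sZ J n (J (elem_tensor p sY a y)) = sY (a n) y)"
proof -
  have "\<exists>!G. bounded_op sZ sY G \<and> (\<forall>a\<in>lp p. \<forall>y. G (J (elem_tensor p sY a y)) = sY (a n) y)"
    using coordinate_operator_exists[of n] by (rule ex_ex1I) (auto intro: bounded_op_eq_if_eq_on_elem_tensors)
  then show ?thesis
    unfolding \<Gamma>_def by (rule theI')
qed

lemma \<Gamma>_L: "\<Gamma> p sY sZ J n (L p sY J m y) = (if m = n then y else 0)"
proof -
  have "\<Gamma> p sY sZ J n (L p sY J m y) = sY (unit_seq m n) y"
    using \<Gamma>_coordinate_operator[of n] unit_seq_in_lp[of m p] unfolding L_def by blast
  then show ?thesis by (simp add: unit_seq_def)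
qed


section \<open>Analysis and synthesis operators\<close>

text \<open>The continuous operator \<open>\<Gamma> n\<close> may be applied to the analysis series termwise, and it
  annihilates every term except the \<open>n\<close>-th.\<close>

lemma \<Gamma>_analysis_op:
  assumes "summable (\<lambda>n. L p sY J n (C n x))"
  shows "\<Gamma> p sY sZ J n (analysis_op p sY J C x) = C n x"
proof -
  interpret \<Gamma>: bounded_linear "\<Gamma> p sY sZ J n"
    using \<Gamma>_coordinate_operator[of n] bounded_op_bounded_linear by blast
  have "(\<lambda>m. L p sY J m (C m x)) sums analysis_op p sY J C x"
    using assms unfolding analysis_op_def by (rule summable_sums)
  from \<Gamma>.sums[OF this]
  have "(\<lambda>m. if m = n then C m x else 0) sums \<Gamma> p sY sZ J n (analysis_op p sY J C x)"
    by (simp add: \<Gamma>_L)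
  then show ?thesis
    using sums_single[of n "\<lambda>m. C m x"] sums_unique2 by blast
qed

text \<open>The factorisation through the tensor product, for an analysis family and a synthesis family
  that may come from different frames.  It supplies the convergence of the mixed
  series as well as its value.\<close>

lemma sums_synthesis_analysis:
  assumes "summable (\<lambda>n. L p sY J n (C n x))"
    and "\<And>z. summable (\<lambda>n. \<Psi> n (\<Gamma> p sY sZ J n z))"
  shows "(\<lambda>n. \<Psi> n (C n x)) sums synthesis_op p sY sZ J \<Psi> (analysis_op p sY J C x)"
  using summable_sums[OF assms(2)[of "analysis_op p sY J C x"]]
  by (simp add: \<Gamma>_analysis_op[where C = C and x = x, OF assms(1)] synthesis_op_def)

end

lemma sums_Pair:
  assumes "f sums a" and "g sums b"
  shows "(\<lambda>n. (f n, g n)) sums (a, b)"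
proof -
  have "(\<Sum>i<n. (f i, g i)) = (\<Sum>i<n. f i, \<Sum>i<n. g i)" for n
    by (simp add: prod_eq_iff fst_sum snd_sum)
  then show ?thesis
    using assms unfolding sums_def by (simp add: tendsto_Pair)
qed


section \<open>The direct sum of orthogonal frames\<close>

theorem proposition3p10:
  fixes p :: real
    and sX :: "'k::real_normed_field \<Rightarrow> 'x::banach \<Rightarrow> 'x"
    and sY :: "'k \<Rightarrow> 'y::banach \<Rightarrow> 'y"
    and sZ :: "'k \<Rightarrow> 'z::banach \<Rightarrow> 'z"
    and N :: "('k, 'y) tensor \<Rightarrow> real"
    and J :: "('k, 'y) tensor \<Rightarrow> 'z"
    and A B :: "nat \<Rightarrow> 'x \<Rightarrow> 'y"
    and \<Psi> \<Phi> :: "nat \<Rightarrow> 'y \<Rightarrow> 'x"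
  assumes "banach_over sX" and "lp_tensor_completion p sY sZ N J"
    and "orthogonal_ov_pASF p sX sY sZ J A \<Psi> B \<Phi>"
  shows "ov_pASF p (module_prod.scale sX sX) sY sZ J (sum_analysis A B) (sum_synthesis \<Psi> \<Phi>) \<and>
    (parseval_ov_pASF p sX sY sZ J A \<Psi> \<and> parseval_ov_pASF p sX sY sZ J B \<Phi> \<longrightarrow>
      parseval_ov_pASF p (module_prod.scale sX sX) sY sZ J (sum_analysis A B) (sum_synthesis \<Psi> \<Phi>))"
proof -
  interpret X: banach_over sX by (rule assms(1))
  interpret lp_tensor_completion p sY sZ N J by (rule assms(2))
  let ?sXX = "module_prod.scale sX sX"
  let ?L = "L p sY J" and ?\<Gamma> = "\<Gamma> p sY sZ J"
  let ?an = "analysis_op p sY J" and ?syn = "synthesis_op p sY sZ J"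
  note vs = Y.vector_space_axioms Z.vector_space_axioms
  have A: "bounded_op sX sY (A n)" "summable (\<lambda>n. ?L n (A n x))" "bounded_op sX sZ (?an A)"
    and B: "bounded_op sX sY (B n)" "summable (\<lambda>n. ?L n (B n x))" "bounded_op sX sZ (?an B)"
    and \<Psi>: "bounded_op sY sX (\<Psi> n)" "summable (\<lambda>n. \<Psi> n (?\<Gamma> n z))" "bounded_op sZ sX (?syn \<Psi>)"
    and \<Phi>: "bounded_op sY sX (\<Phi> n)" "summable (\<lambda>n. \<Phi> n (?\<Gamma> n z))" "bounded_op sZ sX (?syn \<Phi>)"
    and S: "summable (\<lambda>n. \<Psi> n (A n x))" "invertible_op sX (frame_op A \<Psi>)"
      "summable (\<lambda>n. \<Phi> n (B n x))" "invertible_op sX (frame_op B \<Phi>)"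
    and orth: "?syn \<Psi> (?an B x) = 0" "?syn \<Phi> (?an A x) = 0"
    for n x z
    using assms(3) by (auto simp: orthogonal_ov_pASF_def ov_pASF_def fun_eq_iff)

  \<comment> \<open>orthogonality kills the off-diagonal entries of the frame operator of the direct sum\<close>
  have \<Psi>B: "(\<lambda>n. \<Psi> n (B n x)) sums 0" and \<Phi>A: "(\<lambda>n. \<Phi> n (A n x)) sums 0" for x
    using sums_synthesis_analysis[of B _ \<Psi>, OF B(2) \<Psi>(2)]
      sums_synthesis_analysis[of A _ \<Phi>, OF A(2) \<Phi>(2)]
    by (simp_all add: orth)
  have \<Psi>A: "(\<lambda>n. \<Psi> n (A n x)) sums frame_op A \<Psi> x"
    and \<Phi>B: "(\<lambda>n. \<Phi> n (B n x)) sums frame_op B \<Phi> x" for x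
    unfolding frame_op_def by (intro summable_sums S)+
  have frame: "(\<lambda>n. sum_synthesis \<Psi> \<Phi> n (sum_analysis A B n x)) sums
      map_prod (frame_op A \<Psi>) (frame_op B \<Phi>) x" for x
    using sums_Pair[OF sums_add[OF \<Psi>A \<Psi>B] sums_add[OF \<Phi>A \<Phi>B], of "fst x" "snd x" "fst x" "snd x"]
    by (simp add: sum_synthesis_def sum_analysis_def map_prod_def case_prod_unfold
        linear_add[OF bounded_linear.linear[OF bounded_op_bounded_linear[OF \<Psi>(1)]]]
        linear_add[OF bounded_linear.linear[OF bounded_op_bounded_linear[OF \<Phi>(1)]]])
  then have frame_op: "frame_op (sum_analysis A B) (sum_synthesis \<Psi> \<Phi>) =
      map_prod (frame_op A \<Psi>) (frame_op B \<Phi>)"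
    by (simp add: fun_eq_iff frame_op_def sums_iff)

  have an: "(\<lambda>n. ?L n (sum_analysis A B n x)) sums (?an A (fst x) + ?an B (snd x))" for x
    using sums_add[OF summable_sums[OF A(2)] summable_sums[OF B(2)], of "fst x" "snd x"]
    by (simp add: sum_analysis_def analysis_op_def case_prod_unfold
        linear_add[OF bounded_linear.linear[OF bounded_linear_L]])
  then have an_op: "?an (sum_analysis A B) = (\<lambda>x. ?an A (fst x) + ?an B (snd x))"
    by (simp add: fun_eq_iff analysis_op_def sums_iff)
  have syn: "(\<lambda>n. sum_synthesis \<Psi> \<Phi> n (?\<Gamma> n z)) sums (?syn \<Psi> z, ?syn \<Phi> z)" for z
    unfolding sum_synthesis_def synthesis_op_def by (intro sums_Pair summable_sums \<Psi>(2) \<Phi>(2))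
  then have syn_op: "?syn (sum_synthesis \<Psi> \<Phi>) = (\<lambda>z. (?syn \<Psi> z, ?syn \<Phi> z))"
    by (simp add: fun_eq_iff synthesis_op_def sums_iff)

  have "ov_pASF p ?sXX sY sZ J (sum_analysis A B) (sum_synthesis \<Psi> \<Phi>)"
    unfolding ov_pASF_def frame_op an_op syn_op
    using X.bounded_op_add_components[OF vs(1) A(1) B(1)] X.bounded_op_Pair[OF vs(1) \<Psi>(1) \<Phi>(1)]
      X.bounded_op_add_components[OF vs(2) A(3) B(3)] X.bounded_op_Pair[OF vs(2) \<Psi>(3) \<Phi>(3)]
      X.invertible_op_map_prod[OF S(2) S(4)] frame an syn
    by (auto simp: sums_iff sum_analysis_def sum_synthesis_def case_prod_unfold)
  then show ?thesis
    by (simp add: parseval_ov_pASF_def frame_op map_prod.id)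
qed

end
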